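(* Let $u$ be a lattice uniformity on a distributive lattice $L$ and let $S$ be a sublattice of $L$. Then $S$ is closed with respect to the $u^*$-topology if and only if it is closed with respect to the $u$-topology; likewise, $S$ is sequentially closed with respect to the $u^*$-topology if and only if it is sequentially closed with respect to the $u$-topology.
   Context: A lattice uniformity on a lattice $L$ is a (not necessarily Hausdorff) uniformity on $L$ making $\vee$ and $\wedge$ uniformly continuous as maps $L\times L\to L$. The $u$-topology is the topology induced by $u$. A subset of a topological space is sequentially closed if it contains every limit of every convergent sequence contained in it. For $a,b\in L$ let $f_{a,b}:L\to L$, $f_{a,b}(x):=(x\wedge b)\vee a$, and let $J(L):=\{(a,b)\in L^2:a\le b\}$. $u^*$ is the initial uniformity of the family of maps $f_{a,b}:L\to(L,u)$, $(a,b)\in J(L)$, i.e. the uniformity with subbase consisting of the sets $\{(x,y)\in L^2:(f_{a,b}(x),f_{a,b}(y))\in U\}$ with $(a,b)\in J(L)$, $U\in u$. *)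

theory Defs
  imports "HOL-Analysis.Analysis"
begin

text \<open>
  The type class \<^class>\<open>uniform_space\<close> provides one uniformity per type. Two uniformities on the
  same set are compared here, so uniformities are explicit filters of entourages; the conditions
  and the induced topology are those of the type class.
\<close>

definition is_uniformity :: "('a \<times> 'a) filter \<Rightarrow> bool" where
  "is_uniformity u \<longleftrightarrow>
     (\<forall>E. eventually E u \<longrightarrow> (\<forall>x. E (x, x))) \<and>
     (\<forall>E. eventually E u \<longrightarrow> eventually (\<lambda>(x, y). E (y, x)) u) \<and>
     (\<forall>E. eventually E u \<longrightarrow>
        (\<exists>D. eventually D u \<and> (\<forall>x y z. D (x, y) \<longrightarrow> D (y, z) \<longrightarrow> E (x, z))))"

definition uniformity_topology :: "('a \<times> 'a) filter \<Rightarrow> 'a topology" where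
  "uniformity_topology u = topology (\<lambda>U. \<forall>x\<in>U. \<forall>\<^sub>F (x', y) in u. x' = x \<longrightarrow> y \<in> U)"

lemma openin_uniformity_topology:
  "openin (uniformity_topology u) U \<longleftrightarrow> (\<forall>x\<in>U. \<forall>\<^sub>F (x', y) in u. x' = x \<longrightarrow> y \<in> U)"
proof -
  have "istopology (\<lambda>U. \<forall>x\<in>U. \<forall>\<^sub>F (x', y) in u. x' = x \<longrightarrow> y \<in> U)"
    unfolding istopology_def
  proof (intro conjI allI impI ballI)
    fix S T :: "'a set" and x
    assume S: "\<forall>x\<in>S. \<forall>\<^sub>F (x', y) in u. x' = x \<longrightarrow> y \<in> S"
      and T: "\<forall>x\<in>T. \<forall>\<^sub>F (x', y) in u. x' = x \<longrightarrow> y \<in> T" and x: "x \<in> S \<inter> T"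
    have "\<forall>\<^sub>F (x', y) in u. x' = x \<longrightarrow> y \<in> S" "\<forall>\<^sub>F (x', y) in u. x' = x \<longrightarrow> y \<in> T"
      using S T x by auto
    then show "\<forall>\<^sub>F (x', y) in u. x' = x \<longrightarrow> y \<in> S \<inter> T"
      by (rule eventually_elim2) auto
  next
    fix K :: "'a set set" and x
    assume K: "\<forall>S\<in>K. \<forall>x\<in>S. \<forall>\<^sub>F (x', y) in u. x' = x \<longrightarrow> y \<in> S" and "x \<in> \<Union>K"
    then obtain S where S: "S \<in> K" "x \<in> S" by blast
    with K have "\<forall>\<^sub>F (x', y) in u. x' = x \<longrightarrow> y \<in> S" by blast
    then show "\<forall>\<^sub>F (x', y) in u. x' = x \<longrightarrow> y \<in> \<Union>K"
      by (rule eventually_mono) (use S in auto)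
  qed
  then show ?thesis
    by (simp add: uniformity_topology_def)
qed

lemma topspace_uniformity_topology [simp]: "topspace (uniformity_topology u) = UNIV"
proof -
  have "openin (uniformity_topology u) UNIV"
    by (simp add: openin_uniformity_topology case_prod_unfold)
  then show ?thesis
    using openin_subset by blast
qed

lemma is_uniformity_iff_class:
  "is_uniformity u \<longleftrightarrow> class.uniform_space (openin (uniformity_topology u)) u"
proof -
  have "class.open_uniformity (openin (uniformity_topology u)) u"
    by unfold_locales
      (use topspace_uniformity_topology[of u] openin_topspace[of "uniformity_topology u"]
       in \<open>auto simp: openin_uniformity_topology\<close>)
  then show ?thesis
    by (simp add: is_uniformity_def class.uniform_space_def class.uniform_space_axioms_def)
qed

definition uniformly_continuous_map ::
  "('a \<times> 'a) filter \<Rightarrow> ('b \<times> 'b) filter \<Rightarrow> ('a \<Rightarrow> 'b) \<Rightarrow> bool" where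
  "uniformly_continuous_map u v f \<longleftrightarrow> filterlim (\<lambda>(x, y). (f x, f y)) v u"

definition prod_uniformity ::
  "('a \<times> 'a) filter \<Rightarrow> ('b \<times> 'b) filter \<Rightarrow> (('a \<times> 'b) \<times> ('a \<times> 'b)) filter" where
  "prod_uniformity u v = filtermap (\<lambda>((x, x'), (y, y')). ((x, y), (x', y'))) (u \<times>\<^sub>F v)"

text \<open>
  Filters are ordered such that smaller ones have more entourages; hence the infimum is the filter
  with the union of the given filters as subbase.
\<close>

definition initial_uniformity ::
  "'i set \<Rightarrow> ('i \<Rightarrow> 'a \<Rightarrow> 'b) \<Rightarrow> ('b \<times> 'b) filter \<Rightarrow> ('a \<times> 'a) filter" where
  "initial_uniformity I g u = (INF i\<in>I. filtercomap (\<lambda>(x, y). (g i x, g i y)) u)"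

lemma eventually_initial_uniformity:
  fixes g :: "'i \<Rightarrow> 'a \<Rightarrow> 'b"
  shows "eventually E (initial_uniformity I g u) \<longleftrightarrow>
      (\<exists>X\<subseteq>I. finite X \<and> (\<exists>Q. (\<forall>i\<in>X. eventually (Q i) u) \<and>
         (\<forall>x y. (\<forall>i\<in>X. Q i (g i x, g i y)) \<longrightarrow> E (x, y))))" (is "_ \<longleftrightarrow> ?R")
proof
  assume "eventually E (initial_uniformity I g u)"
  then obtain X where X: "X \<subseteq> I" "finite X"
      "eventually E (INF i\<in>X. filtercomap (\<lambda>(x, y). (g i x, g i y)) u)"
    unfolding initial_uniformity_def eventually_INF[of E _ I] by blast
  from X(2,3) obtain P where P: "\<forall>i\<in>X. eventually (P i) (filtercomap (\<lambda>(x, y). (g i x, g i y)) u)"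
      "\<forall>z. (\<forall>i\<in>X. P i z) \<longrightarrow> E z"
    by (auto simp: eventually_INF_finite)
  have "\<forall>i\<in>X. \<exists>Q. eventually Q u \<and> (\<forall>x y. Q (g i x, g i y) \<longrightarrow> P i (x, y))"
    using P(1) by (auto simp: eventually_filtercomap)
  then obtain Q where "\<forall>i\<in>X. eventually (Q i) u \<and> (\<forall>x y. Q i (g i x, g i y) \<longrightarrow> P i (x, y))"
    by metis
  then show ?R
    using X P(2) by (intro exI[of _ X] conjI exI[of _ Q]) auto
next
  assume ?R
  then obtain X Q where X: "X \<subseteq> I" "finite X" and Q: "\<forall>i\<in>X. eventually (Q i) u"
      "\<forall>x y. (\<forall>i\<in>X. Q i (g i x, g i y)) \<longrightarrow> E (x, y)"
    by (elim exE conjE)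
  have "eventually (\<lambda>(x, y). Q i (g i x, g i y)) (initial_uniformity I g u)" if "i \<in> X" for i
  proof (rule filter_leD)
    show "initial_uniformity I g u \<le> filtercomap (\<lambda>(x, y). (g i x, g i y)) u"
      unfolding initial_uniformity_def using that X(1) by (intro INF_lower) auto
    show "eventually (\<lambda>(x, y). Q i (g i x, g i y)) (filtercomap (\<lambda>(x, y). (g i x, g i y)) u)"
      using Q(1) that by (auto simp: eventually_filtercomap)
  qed
  then have "eventually (\<lambda>z. \<forall>i\<in>X. case z of (x, y) \<Rightarrow> Q i (g i x, g i y))
      (initial_uniformity I g u)"
    using X(2) by (simp add: eventually_ball_finite)
  then show "eventually E (initial_uniformity I g u)"
    by (rule eventually_mono) (use Q(2) in auto)
qed

lemma is_uniformity_initial_uniformity: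
  fixes g :: "'i \<Rightarrow> 'a \<Rightarrow> 'b"
  assumes u: "is_uniformity u"
  shows "is_uniformity (initial_uniformity I g u)"
proof -
  let ?R = "\<lambda>E.
      (\<exists>X\<subseteq>I. finite X \<and> (\<exists>Q. (\<forall>i\<in>X. eventually (Q i) u) \<and>
         (\<forall>x y. (\<forall>i\<in>X. Q i (g i x, g i y)) \<longrightarrow> E (x, y))))"
  have refl: "E (x, x)" if "eventually E u" for E x
    using u that by (auto simp: is_uniformity_def)
  have sym: "eventually (\<lambda>(x, y). E (y, x)) u" if "eventually E u" for E
    using u that by (auto simp: is_uniformity_def)
  have trans: "\<exists>D. eventually D u \<and> (\<forall>x y z. D (x, y) \<longrightarrow> D (y, z) \<longrightarrow> E (x, z))"
    if "eventually E u" for E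
    using u that by (auto simp: is_uniformity_def)
  show ?thesis
    unfolding is_uniformity_def eventually_initial_uniformity
  proof (intro conjI allI impI)
    fix E and x :: 'a
    assume "?R E"
    then obtain X Q where Q: "\<forall>i\<in>X. eventually (Q i) u"
        "\<forall>x y. (\<forall>i\<in>X. Q i (g i x, g i y)) \<longrightarrow> E (x, y)"
      by (elim exE conjE)
    have "Q i (g i x, g i x)" if "i \<in> X" for i
      using Q(1) that by (blast intro: refl[of "Q i"])
    then show "E (x, x)"
      using Q(2) by blast
  next
    fix E assume "?R E"
    then obtain X Q where X: "X \<subseteq> I" "finite X" and Q: "\<forall>i\<in>X. eventually (Q i) u"
        "\<forall>x y. (\<forall>i\<in>X. Q i (g i x, g i y)) \<longrightarrow> E (x, y)"
      by (elim exE conjE)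
    have "eventually (\<lambda>(x, y). Q i (y, x)) u" if "i \<in> X" for i
      using Q(1) that by (blast intro: sym[of "Q i"])
    then show "?R (\<lambda>(x, y). E (y, x))"
      using X Q(2) by (intro exI[of _ X] conjI exI[of _ "\<lambda>i (x, y). Q i (y, x)"]) simp_all
  next
    fix E assume "?R E"
    then obtain X Q where X: "X \<subseteq> I" "finite X" and Q: "\<forall>i\<in>X. eventually (Q i) u"
        "\<forall>x y. (\<forall>i\<in>X. Q i (g i x, g i y)) \<longrightarrow> E (x, y)"
      by (elim exE conjE)
    have "\<forall>i\<in>X. \<exists>D. eventually D u \<and> (\<forall>x y z. D (x, y) \<longrightarrow> D (y, z) \<longrightarrow> Q i (x, z))"
    proof
      fix i assume "i \<in> X"
      then show "\<exists>D. eventually D u \<and> (\<forall>x y z. D (x, y) \<longrightarrow> D (y, z) \<longrightarrow> Q i (x, z))"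
        using Q(1) trans[of "Q i"] by blast
    qed
    then obtain D where D: "\<forall>i\<in>X. eventually (D i) u \<and>
        (\<forall>x y z. D i (x, y) \<longrightarrow> D i (y, z) \<longrightarrow> Q i (x, z))"
      by (elim exE[OF bchoice])
    show "\<exists>D. ?R D \<and> (\<forall>x y z. D (x, y) \<longrightarrow> D (y, z) \<longrightarrow> E (x, z))"
    proof (intro exI[of _ "\<lambda>(x, y). \<forall>i\<in>X. D i (g i x, g i y)"] conjI)
      show "?R (\<lambda>(x, y). \<forall>i\<in>X. D i (g i x, g i y))"
        using X D by (intro exI[of _ X] conjI exI[of _ D]) auto
      show "\<forall>x y z. (case (x, y) of (x, y) \<Rightarrow> \<forall>i\<in>X. D i (g i x, g i y)) \<longrightarrow>
          (case (y, z) of (x, y) \<Rightarrow> \<forall>i\<in>X. D i (g i x, g i y)) \<longrightarrow> E (x, z)"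
      proof (intro allI impI)
        fix x y z
        assume "case (x, y) of (x, y) \<Rightarrow> \<forall>i\<in>X. D i (g i x, g i y)"
          and "case (y, z) of (x, y) \<Rightarrow> \<forall>i\<in>X. D i (g i x, g i y)"
        then have "\<forall>i\<in>X. Q i (g i x, g i z)"
          using D by (simp only: prod.case) blast
        then show "E (x, z)"
          using Q(2) by simp
      qed
    qed
  qed
qed

definition lattice_uniformity :: "('a::lattice \<times> 'a) filter \<Rightarrow> bool" where
  "lattice_uniformity u \<longleftrightarrow>
     is_uniformity u \<and>
     uniformly_continuous_map (prod_uniformity u u) u (\<lambda>(x, y). sup x y) \<and>
     uniformly_continuous_map (prod_uniformity u u) u (\<lambda>(x, y). inf x y)"

definition ordered_pairs :: "('a::lattice \<times> 'a) set" where
  "ordered_pairs = {(a, b). a \<le> b}"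

definition interval_map :: "'a::lattice \<times> 'a \<Rightarrow> 'a \<Rightarrow> 'a" where
  "interval_map = (\<lambda>(a, b) x. sup (inf x b) a)"

definition ustar :: "('a::lattice \<times> 'a) filter \<Rightarrow> ('a \<times> 'a) filter" where
  "ustar u = initial_uniformity ordered_pairs interval_map u"

definition sublattice :: "'a::lattice set \<Rightarrow> bool" where
  "sublattice S \<longleftrightarrow> (\<forall>x\<in>S. \<forall>y\<in>S. sup x y \<in> S \<and> inf x y \<in> S)"

definition sequentially_closedin :: "'a topology \<Rightarrow> 'a set \<Rightarrow> bool" where
  "sequentially_closedin X S \<longleftrightarrow>
     S \<subseteq> topspace X \<and>
     (\<forall>\<sigma> l. range \<sigma> \<subseteq> S \<and> limitin X \<sigma> l sequentially \<longrightarrow> l \<in> S)"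

end

theory Submission
  imports Defs
begin

text \<open>
  Each \<open>f\<^sub>a\<^sub>,\<^sub>b\<close> is \<open>u\<close>-uniformly continuous, so \<open>u\<^sup>*\<close> is coarser than \<open>u\<close>. Conversely, let \<open>S\<close> be
  \<open>u\<close>-closed and let a net \<open>s\<^sub>\<alpha>\<close> in \<open>S\<close> converge to \<open>x\<close> in \<open>u\<^sup>*\<close>. For \<open>s, t \<in> S\<close>, the map \<open>f\<^sub>a\<^sub>,\<^sub>b\<close> with
  \<open>a = s \<and> t\<close>, \<open>b = t\<close> takes the net into \<open>S\<close>, and by distributivity its \<open>u\<close>-limit is
  \<open>(x \<or> s) \<and> t\<close>, which is therefore in \<open>S\<close>; replacing \<open>(s, t)\<close> by \<open>(t, s \<or> t)\<close> gives
  \<open>(x \<and> s) \<or> t \<in> S\<close>. Now fix \<open>s \<in> S\<close>. With \<open>a = x \<and> s\<close> and \<open>b = x \<or> s\<close>, two applications of this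
  show that \<open>f\<^sub>a\<^sub>,\<^sub>b\<close> maps \<open>S\<close> into \<open>S\<close>, while \<open>f\<^sub>a\<^sub>,\<^sub>b(s\<^sub>\<alpha>)\<close> \<open>u\<close>-converges to \<open>f\<^sub>a\<^sub>,\<^sub>b(x) = x\<close>.
\<close>

lemma uniformly_continuous_imp_continuous_map:
  assumes "uniformly_continuous_map u v f"
  shows "continuous_map (uniformity_topology u) (uniformity_topology v) f"
  unfolding continuous_map_def
proof (intro conjI allI impI)
  fix U assume U: "openin (uniformity_topology v) U"
  show "openin (uniformity_topology u) {x \<in> topspace (uniformity_topology u). f x \<in> U}"
    unfolding openin_uniformity_topology
  proof
    fix x assume "x \<in> {x \<in> topspace (uniformity_topology u). f x \<in> U}"
    then have "\<forall>\<^sub>F (x', y) in v. x' = f x \<longrightarrow> y \<in> U"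
      using U by (auto simp: openin_uniformity_topology)
    then have "\<forall>\<^sub>F z in u. case (case z of (x, y) \<Rightarrow> (f x, f y)) of (x', y) \<Rightarrow> x' = f x \<longrightarrow> y \<in> U"
      using assms unfolding uniformly_continuous_map_def filterlim_iff by blast
    then show "\<forall>\<^sub>F (x', y) in u. x' = x \<longrightarrow>
        y \<in> {x \<in> topspace (uniformity_topology u). f x \<in> U}"
      by (rule eventually_mono) auto
  qed
qed simp

lemma uniformly_continuous_map_interval_map:
  assumes "lattice_uniformity u"
  shows "uniformly_continuous_map u u (interval_map p)"
proof -
  obtain a b where p: "p = (a, b)" by (cases p)
  \<comment> \<open>Every entourage contains the diagonal.\<close>
  have const: "filterlim (\<lambda>_. (c, c)) u F" for c and F :: "('a \<times> 'a) filter"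
    using assms by (auto simp: filterlim_iff lattice_uniformity_def is_uniformity_def intro!: always_eventually)
  \<comment> \<open>One argument of \<open>h\<close> is frozen at \<open>c\<close>; the free
    \<open>f\<close> allows meeting with \<open>b\<close> first and joining with \<open>a\<close>
    afterwards.\<close>
  have binop: "filterlim (\<lambda>z. (h (fst (f z), c), h (snd (f z), c))) u u"
    if h: "uniformly_continuous_map (prod_uniformity u u) u h" and f: "filterlim f u u"
    for h c and f :: "'a \<times> 'a \<Rightarrow> 'a \<times> 'a"
  proof -
    have "filterlim (\<lambda>z. (f z, (c, c))) (u \<times>\<^sub>F u) u"
      by (intro filterlim_Pair f const)
    then have "filterlim (\<lambda>z. ((fst (f z), c), (snd (f z), c))) (prod_uniformity u u) u"
      unfolding prod_uniformity_def filterlim_def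
      by (drule_tac filtermap_mono[where f = "\<lambda>((x, x'), (y, y')). ((x, y), (x', y'))"])
        (simp add: filtermap_filtermap case_prod_unfold)
    from filterlim_compose[OF h[unfolded uniformly_continuous_map_def] this]
    show ?thesis by simp
  qed
  have "filterlim (\<lambda>z. (inf (fst z) b, inf (snd z) b)) u u"
    using binop[of "\<lambda>(x, y). inf x y" "\<lambda>z. z" b] assms filterlim_ident
    by (auto simp: lattice_uniformity_def)
  then have "filterlim (\<lambda>z. (sup (inf (fst z) b) a, sup (inf (snd z) b) a)) u u"
    using binop[of "\<lambda>(x, y). sup x y" "\<lambda>z. (inf (fst z) b, inf (snd z) b)" a] assms
    by (auto simp: lattice_uniformity_def)
  then show ?thesis
    by (simp add: uniformly_continuous_map_def p interval_map_def case_prod_unfold)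
qed

lemma le_ustar:
  assumes "lattice_uniformity u"
  shows "u \<le> ustar u"
  unfolding ustar_def initial_uniformity_def
proof (rule INF_greatest)
  fix p
  show "u \<le> filtercomap (\<lambda>(x, y). (interval_map p x, interval_map p y)) u"
    using uniformly_continuous_map_interval_map[OF assms, of p]
    by (simp add: uniformly_continuous_map_def filterlim_def filtermap_le_iff_le_filtercomap)
qed

lemma openin_uniformity_topology_mono:
  assumes "u \<le> v" and "openin (uniformity_topology v) U"
  shows "openin (uniformity_topology u) U"
  using assms(2) filter_leD[OF assms(1)] unfolding openin_uniformity_topology by blast

lemma limitin_uniformity_topology_mono:
  assumes "u \<le> v" and "limitin (uniformity_topology u) f l F"
  shows "limitin (uniformity_topology v) f l F"
  using assms(2) openin_uniformity_topology_mono[OF assms(1)] by (auto simp: limitin_def)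

lemma continuous_map_interval_map_ustar:
  assumes "a \<le> b"
  shows "continuous_map (uniformity_topology (ustar u)) (uniformity_topology u) (interval_map (a, b))"
proof (rule uniformly_continuous_imp_continuous_map)
  have "ustar u \<le> filtercomap (\<lambda>(x, y). (interval_map (a, b) x, interval_map (a, b) y)) u"
    unfolding ustar_def initial_uniformity_def
    using assms by (intro INF_lower) (simp add: ordered_pairs_def)
  then show "uniformly_continuous_map (ustar u) u (interval_map (a, b))"
    by (simp add: uniformly_continuous_map_def filterlim_def filtermap_le_iff_le_filtercomap)
qed

text \<open>Since \<open>closed\<close> concerns only limits along the given \<open>F\<close>, one
  argument serves both closedness and, with \<open>F = sequentially\<close>, sequential
  closedness.\<close>

lemma limit_ustar_in_sublattice:
  fixes u :: "('a::distrib_lattice \<times> 'a) filter" and \<sigma> :: "'i \<Rightarrow> 'a"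
  assumes S: "sublattice S"
    and \<sigma>: "\<And>i. \<sigma> i \<in> S" and x: "limitin (uniformity_topology (ustar u)) \<sigma> x F"
    and closed: "\<And>\<tau> l. range \<tau> \<subseteq> S \<Longrightarrow> limitin (uniformity_topology u) \<tau> l F \<Longrightarrow> l \<in> S"
  shows "x \<in> S"
proof -
  have image: "interval_map (a, b) x \<in> S"
    if "a \<le> b" "\<And>y. y \<in> S \<Longrightarrow> interval_map (a, b) y \<in> S" for a b
    using closed[of "interval_map (a, b) \<circ> \<sigma>"] that \<sigma>
      continuous_map_limit[OF continuous_map_interval_map_ustar[OF that(1)] x] by auto
  have meet: "inf (sup x s) t \<in> S" if "s \<in> S" "t \<in> S" for s t
    using image[of "inf s t" t] that S
    by (simp add: interval_map_def sublattice_def inf_sup_distrib2)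
  have join: "sup (inf x s) t \<in> S" if "s \<in> S" "t \<in> S" for s t
    using meet[of t "sup s t"] that S by (simp add: sublattice_def sup_inf_distrib2)
  \<comment> \<open>Any element of \<open>S\<close> will do; the net supplies one.\<close>
  define s where "s = \<sigma> undefined"
  have s: "s \<in> S" by (simp add: s_def \<sigma>)
  \<comment> \<open>\<open>meet\<close> puts \<open>inf (sup x s) y\<close> into \<open>S\<close>;
    \<open>join\<close> with this element as \<open>t\<close> gives the value at
    \<open>y\<close>.\<close>
  have "interval_map (inf x s, sup x s) y \<in> S" if "y \<in> S" for y
    using join[OF s meet[OF s that]] by (simp add: interval_map_def sup_commute inf_commute)
  then have "interval_map (inf x s, sup x s) x \<in> S"
    by (intro image) (simp_all add: le_infI1)
  then show ?thesis
    by (simp add: interval_map_def sup_absorb1)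
qed

text \<open>The trace on \<open>S\<close> of the neighbourhood filter of \<open>x\<close> is proper
  because every neighbourhood meets \<open>S\<close>.\<close>

lemma in_closure_of_obtain_limit:
  fixes X :: "'a topology"
  assumes "x \<in> X closure_of S"
  obtains \<sigma> :: "'a \<Rightarrow> 'a" and F where "range \<sigma> \<subseteq> S" "F \<noteq> bot" "limitin X \<sigma> x F"
proof -
  have x: "x \<in> topspace X" and meets: "\<And>T. x \<in> T \<Longrightarrow> openin X T \<Longrightarrow> \<exists>y\<in>S. y \<in> T"
    using assms by (auto simp: in_closure_of)
  from meets[OF x] obtain s where s: "s \<in> S" by auto
  define F where "F = inf (nhdsin X x) (principal S)"
  \<comment> \<open>The default \<open>s\<close> off \<open>S\<close> keeps the whole range in
    \<open>S\<close>; it is invisible to \<open>F\<close>.\<close>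
  define \<sigma> where "\<sigma> y = (if y \<in> S then y else s)" for y
  show thesis
  proof (rule that)
    show "range \<sigma> \<subseteq> S" using s by (auto simp: \<sigma>_def)
    show "F \<noteq> bot"
      unfolding F_def trivial_limit_def eventually_inf_principal eventually_nhdsin
      using x meets by auto
    show "limitin X \<sigma> x F"
      unfolding limitin_def F_def eventually_inf_principal eventually_nhdsin
      using x by (auto simp: \<sigma>_def)
  qed
qed

theorem theorem5p8:
  fixes u :: "('a::distrib_lattice \<times> 'a) filter" and S :: "'a set"
  assumes "lattice_uniformity u" and "sublattice S"
  shows "(closedin (uniformity_topology (ustar u)) S \<longleftrightarrow>
            closedin (uniformity_topology u) S) \<and>
         (sequentially_closedin (uniformity_topology (ustar u)) S \<longleftrightarrow>
            sequentially_closedin (uniformity_topology u) S)"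
proof (intro conjI iffI)
  \<comment> \<open>The coarser \<open>ustar u\<close> has fewer closed sets and more limits, which
    gives both implications from \<open>ustar u\<close> to \<open>u\<close>.\<close>
  note le = le_ustar[OF assms(1)]
  show "closedin (uniformity_topology u) S" if "closedin (uniformity_topology (ustar u)) S"
    using that openin_uniformity_topology_mono[OF le] by (simp add: closedin_def)
  show "sequentially_closedin (uniformity_topology u) S"
    if "sequentially_closedin (uniformity_topology (ustar u)) S"
    using that limitin_uniformity_topology_mono[OF le]
    by (simp add: sequentially_closedin_def) blast
  show "closedin (uniformity_topology (ustar u)) S" if "closedin (uniformity_topology u) S"
  proof -
    have "x \<in> S" if "x \<in> uniformity_topology (ustar u) closure_of S" for x
      using that
    proof (rule in_closure_of_obtain_limit)
      fix \<sigma> :: "'a \<Rightarrow> 'a" and F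
      assume \<sigma>: "range \<sigma> \<subseteq> S" "F \<noteq> bot" "limitin (uniformity_topology (ustar u)) \<sigma> x F"
      show "x \<in> S"
      proof (rule limit_ustar_in_sublattice[OF assms(2) _ \<sigma>(3)])
        fix \<tau> l assume "range \<tau> \<subseteq> S" "limitin (uniformity_topology u) \<tau> l F"
        \<comment> \<open>A closed set contains the limits of its nets along proper filters, whence
          \<open>F \<noteq> bot\<close>.\<close>
        then show "l \<in> S"
          using limitin_closedin[OF _ \<open>closedin (uniformity_topology u) S\<close>] \<sigma>(2)
          by (metis always_eventually range_subsetD)
      qed (use \<sigma>(1) in blast)
    qed
    then show ?thesis
      by (simp add: closure_of_subset_eq[symmetric] subsetI)
  qed
  show "sequentially_closedin (uniformity_topology (ustar u)) S"
    if "sequentially_closedin (uniformity_topology u) S"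
    unfolding sequentially_closedin_def
  proof (intro conjI allI impI)
    fix \<sigma> l
    assume "range \<sigma> \<subseteq> S \<and> limitin (uniformity_topology (ustar u)) \<sigma> l sequentially"
    then show "l \<in> S"
      using that
      by (intro limit_ustar_in_sublattice[OF assms(2), of \<sigma> u l sequentially])
        (auto simp: sequentially_closedin_def)
  qed simp
qed

end
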